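(* Let $b\colon[0,\infty)\to[0,\infty)$ be a nondecreasing function which is non-constant on $(0,\infty)$. (i) The (generalized) $b$-moment $\mathsf{E}\,b(|T_p|)$ of the random variable $|T_p|$ is nonincreasing in $p\in(0,\infty]$, and so, the "finiteness" set $$F_b:=\{p\in(0,\infty]\colon \mathsf{E}\,b(|T_p|)<\infty\}$$ of the $b$-moment is an interval of the form $[p_b,\infty)$ or $(p_b,\infty)$, for some $p_b\in(0,\infty]$. Moreover, $\mathsf{E}\,b(|T_p|)$ is (strictly) decreasing in $p\in[p_b,\infty)$. (ii) In particular, for any given $s\in(0,\infty)$, the moment $\mathsf{E}|T_p|^s$ is (strictly) decreasing in $p\in[s,\infty]$ (of course, $\mathsf{E}|T_s|^s=\infty$).
   Context: For real $p>0$, Student's distribution with $p$ degrees of freedom (any positive real $p$) has density $$f_p(x):=\frac{\Gamma\left(\frac{p+1}{2}\right)}{\sqrt{\pi p}\,\Gamma\left(\frac p2\right)}\left(1+\frac{x^2}{p}\right)^{-(p+1)/2},\quad x\in\mathbb{R},$$ and, by continuity, $f_\infty$ is the standard normal density. For $p\in(0,\infty]$, $T_p$ denotes any random variable which has Student's distribution with $p$ degrees of freedom, that is, with density $f_p$; in particular, $T_\infty$ has the standard normal distribution. $\mathsf{E}$ denotes expectation.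
   Formalization: The interval forms are corrected to [p_b,∞] or (p_b,∞] with p_b∈[0,∞], since F_b contains ∞ whenever nonempty and bounded b gives F_b=(0,∞]; strict decrease is stated on [p_b,∞]∩(0,∞]. *)

theory Defs
  imports "HOL-Probability.Probability"
begin

text \<open>The value at \<open>p = \<infinity>\<close> is the pointwise limit of the densities for finite \<open>p\<close>.
  Only \<open>p > 0\<close> is meaningful.\<close>

definition student_density :: "ereal \<Rightarrow> real \<Rightarrow> real" where
  "student_density p x =
     (if p = \<infinity> then std_normal_density x
      else let r = real_of_ereal p in
        Gamma ((r + 1) / 2) / (sqrt (pi * r) * Gamma (r / 2))
          * (1 + x\<^sup>2 / r) powr (- (r + 1) / 2))"

text \<open>The law of \<open>T p\<close> is prescribed for each \<open>p\<close> separately; nothing is assumed about a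
  joint distribution, and the underlying probability space may depend on \<open>p\<close>.\<close>

definition student_family :: "(ereal \<Rightarrow> 'a measure) \<Rightarrow> (ereal \<Rightarrow> 'a \<Rightarrow> real) \<Rightarrow> bool" where
  "student_family M T \<longleftrightarrow>
     (\<forall>p>0. prob_space (M p) \<and>
       distributed (M p) lborel (T p) (\<lambda>x. ennreal (student_density p x)))"

text \<open>The expectation of the nonnegative variable \<open>b \<bar>X\<bar>\<close>, as a value in \<open>[0, \<infinity>]\<close>.\<close>

definition abs_moment :: "'a measure \<Rightarrow> (real \<Rightarrow> real) \<Rightarrow> ('a \<Rightarrow> real) \<Rightarrow> ennreal" where
  "abs_moment M b X = (\<integral>\<^sup>+ \<omega>. ennreal (b \<bar>X \<omega>\<bar>) \<partial>M)"

definition finiteness_set ::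
  "(ereal \<Rightarrow> 'a measure) \<Rightarrow> (ereal \<Rightarrow> 'a \<Rightarrow> real) \<Rightarrow> (real \<Rightarrow> real) \<Rightarrow> ereal set" where
  "finiteness_set M T b = {p. 0 < p \<and> abs_moment (M p) b (T p) < \<infinity>}"

end

theory Submission
  imports Defs
begin

text \<open>
  For \<open>p < q\<close> the logarithm of the ratio of the densities \<open>f\<^sub>p / f\<^sub>q\<close>, as a function of
  \<open>y = x\<^sup>2\<close>, has a derivative of the sign of \<open>y - 1\<close>, and it is nonpositive at \<open>0\<close> since
  \<open>f\<^sub>p(0)\<close> is nondecreasing in \<open>p\<close>. As both densities have mass \<open>1\<close>, there is a \<open>c > 0\<close> with
  \<open>f\<^sub>p < f\<^sub>q\<close> for \<open>0 < \<bar>x\<bar> < c\<close> and \<open>f\<^sub>p > f\<^sub>q\<close> for \<open>\<bar>x\<bar> > c\<close>. Hence the integral of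
  \<open>(f\<^sub>p(x) - f\<^sub>q(x)) (b(\<bar>x\<bar>) - b(c))\<close> is nonnegative, and it vanishes only if \<open>b\<close> is constant
  on the positive half-line.
\<close>

subsection \<open>Monotonicity of the density at the origin\<close>

text \<open>With \<open>z = r / 2\<close> this is the density at \<open>0\<close> for
  \<open>r\<close> degrees of freedom divided by the standard normal density at \<open>0\<close>.
  Its monotonicity in \<open>z\<close> is what the comparison at the origin needs.\<close>

definition gamma_ratio :: "real \<Rightarrow> real" where
  "gamma_ratio z = Gamma (z + 1/2) / (sqrt z * Gamma z)"

text \<open>Log-convexity of \<open>Gamma\<close> at a midpoint, exponentiated. Together with the
  functional equation it controls half-integer shifts and stands in for Stirling
  asymptotics.\<close>

lemma Gamma_midpoint_le:
  fixes x y :: real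
  assumes "0 < x" "0 < y"
  shows "(Gamma ((x + y) / 2))\<^sup>2 \<le> Gamma x * Gamma y"
proof -
  have pos: "0 < Gamma x" "0 < Gamma y" "0 < Gamma ((x + y) / 2)"
    using assms by auto
  have "ln (Gamma ((1 - 1/2) * x + 1/2 * y)) \<le> (1 - 1/2) * ln (Gamma x) + 1/2 * ln (Gamma y)"
    using convex_onD[OF log_convex_Gamma_real, of "1/2" x y] assms by simp
  also have "(1 - 1/2) * x + 1/2 * y = (x + y) / 2"
    by (simp add: field_simps)
  finally have "ln ((Gamma ((x + y) / 2))\<^sup>2) \<le> ln (Gamma x * Gamma y)"
    using pos by (simp add: ln_mult ln_realpow)
  then show ?thesis
    using pos by (subst (asm) ln_le_cancel_iff) auto
qed

lemma Gamma_plus1_pos: "0 < z \<Longrightarrow> Gamma (z + 1) = z * Gamma z" for z :: real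
  by (rule Gamma_plus1) (auto elim!: nonpos_Ints_cases')

lemma gamma_ratio_pos: "0 < z \<Longrightarrow> 0 < gamma_ratio z"
  by (simp add: gamma_ratio_def)

text \<open>The point \<open>z + 1/2\<close> is the midpoint of \<open>z\<close> and
  \<open>z + 1\<close>, and \<open>Gamma (z + 1)\<close> contributes the factor \<open>z\<close>
  that cancels the square root.\<close>

lemma gamma_ratio_square_le:
  assumes "0 < z"
  shows "(gamma_ratio z)\<^sup>2 \<le> 1"
proof -
  have "(Gamma ((z + (z + 1)) / 2))\<^sup>2 \<le> Gamma z * Gamma (z + 1)"
    using assms by (intro Gamma_midpoint_le) auto
  moreover have "(z + (z + 1)) / 2 = z + 1/2"
    by (simp add: field_simps)
  moreover have "Gamma (z + 1) = z * Gamma z"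
    using assms by (rule Gamma_plus1_pos)
  ultimately have "(Gamma (z + 1/2))\<^sup>2 \<le> z * (Gamma z)\<^sup>2"
    by (simp only: power2_eq_square mult_ac)
  moreover have "0 < z * (Gamma z)\<^sup>2"
    using assms Gamma_real_pos[of z] by (intro mult_pos_pos zero_less_power)
  ultimately show ?thesis
    using assms by (simp add: gamma_ratio_def power_divide power_mult_distrib)
qed

text \<open>The companion bound uses that \<open>z + 1\<close> is the midpoint of
  \<open>z + 1/2\<close> and \<open>z + 3/2\<close>. Both bounds tend to \<open>1\<close> for large
  \<open>z\<close>.\<close>

lemma gamma_ratio_square_ge:
  assumes "0 < z"
  shows "z / (z + 1/2) \<le> (gamma_ratio z)\<^sup>2"
proof -
  have "(Gamma (((z + 1/2) + (z + 3/2)) / 2))\<^sup>2 \<le> Gamma (z + 1/2) * Gamma (z + 3/2)"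
    using assms by (intro Gamma_midpoint_le) auto
  moreover have "((z + 1/2) + (z + 3/2)) / 2 = z + 1"
    by (simp add: field_simps)
  moreover have "Gamma (z + 1) = z * Gamma z"
    using assms by (rule Gamma_plus1_pos)
  moreover have "Gamma (z + 3/2) = (z + 1/2) * Gamma (z + 1/2)"
    using assms Gamma_plus1_pos[of "z + 1/2"] by (simp add: add.assoc)
  ultimately have *: "z\<^sup>2 * (Gamma z)\<^sup>2 \<le> (z + 1/2) * (Gamma (z + 1/2))\<^sup>2"
    by (simp only: power2_eq_square mult_ac)
  have "0 < Gamma z" using assms by simp
  then show ?thesis
    using assms * by (simp add: gamma_ratio_def power_divide power_mult_distrib field_simps
      power2_eq_square)
qed

lemma gamma_ratio_shift_tendsto:
  assumes "0 < z"
  shows "(\<lambda>n. gamma_ratio (z + real n)) \<longlonglongrightarrow> 1"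
proof -
  have "(\<lambda>n. (gamma_ratio (z + real n))\<^sup>2) \<longlonglongrightarrow> 1"
  proof (rule tendsto_sandwich)
    show "(\<lambda>n. (z + real n) / (z + real n + 1/2)) \<longlonglongrightarrow> 1"
      by real_asymp
    show "\<forall>\<^sub>F n in sequentially. (z + real n) / (z + real n + 1/2) \<le> (gamma_ratio (z + real n))\<^sup>2"
      using assms by (intro always_eventually allI gamma_ratio_square_ge) auto
    show "\<forall>\<^sub>F n in sequentially. (gamma_ratio (z + real n))\<^sup>2 \<le> 1"
      using assms by (intro always_eventually allI gamma_ratio_square_le) auto
  qed auto
  then have "(\<lambda>n. sqrt ((gamma_ratio (z + real n))\<^sup>2)) \<longlonglongrightarrow> sqrt 1"
    by (rule tendsto_real_sqrt)
  moreover have "0 \<le> gamma_ratio (z + real n)" for n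
    using gamma_ratio_pos[of "z + real n"] assms by simp
  ultimately show ?thesis
    by simp
qed

text \<open>The functional equation gives the factor \<open>(z + 1/2) / sqrt (z * (z + 1))\<close>.
  It is rewritten so that its decrease in \<open>z\<close> is visible.\<close>

lemma gamma_ratio_Suc:
  assumes "0 < z"
  shows "gamma_ratio (z + 1) = gamma_ratio z * sqrt (1 + 1 / (4 * z * (z + 1)))"
proof -
  have "Gamma (z + 1) = z * Gamma z"
    using assms by (rule Gamma_plus1_pos)
  moreover have "Gamma (z + 1 + 1/2) = (z + 1/2) * Gamma (z + 1/2)"
    using assms Gamma_plus1_pos[of "z + 1/2"] by (simp add: add_ac)
  moreover have "sqrt (1 + 1 / (4 * z * (z + 1))) = (z + 1/2) / (sqrt z * sqrt (z + 1))"
  proof -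
    have "1 + 1 / (4 * z * (z + 1)) = (z + 1/2)\<^sup>2 / (z * (z + 1))"
      using assms by (simp add: divide_simps) (simp add: power2_eq_square algebra_simps)
    then show ?thesis
      using assms by (simp add: real_sqrt_divide real_sqrt_mult)
  qed
  ultimately have "gamma_ratio z * sqrt (1 + 1 / (4 * z * (z + 1)))
      = Gamma (z + 1 + 1/2) / (sqrt (z + 1) * ((sqrt z * sqrt z) * Gamma z))"
    by (simp add: gamma_ratio_def mult_ac)
  also have "\<dots> = gamma_ratio (z + 1)"
    using assms by (simp add: gamma_ratio_def Gamma_plus1_pos)
  finally show ?thesis ..
qed

text \<open>The factor of \<open>gamma_ratio_Suc\<close> decreases in \<open>z\<close>, so the quotient of the ratios at \<open>z\<close> and
  at \<open>w\<close> can only grow under integer shifts, in whose limit it is \<open>1\<close>.\<close>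

lemma gamma_ratio_cross_le:
  assumes "0 < z" "z \<le> w"
  shows "gamma_ratio z * gamma_ratio (w + real n) \<le> gamma_ratio w * gamma_ratio (z + real n)"
proof (induction n)
  case (Suc n)
  have "1 / (4 * (w + real n) * (w + real n + 1)) \<le> 1 / (4 * (z + real n) * (z + real n + 1))"
    using assms by (intro divide_left_mono mult_mono) auto
  then have *: "sqrt (1 + 1 / (4 * (w + real n) * (w + real n + 1)))
      \<le> sqrt (1 + 1 / (4 * (z + real n) * (z + real n + 1)))"
    by simp
  have "gamma_ratio z * gamma_ratio (w + real n + 1)
      = (gamma_ratio z * gamma_ratio (w + real n)) * sqrt (1 + 1 / (4 * (w + real n) * (w + real n + 1)))"
    using assms by (subst gamma_ratio_Suc) auto
  also have "\<dots> \<le> (gamma_ratio w * gamma_ratio (z + real n))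
      * sqrt (1 + 1 / (4 * (z + real n) * (z + real n + 1)))"
    using assms gamma_ratio_pos[of w] gamma_ratio_pos[of "z + real n"]
    by (intro mult_mono Suc.IH *) auto
  also have "\<dots> = gamma_ratio w * gamma_ratio (z + real n + 1)"
    using assms gamma_ratio_Suc[of "z + real n"] by simp
  finally show ?case by (simp add: add_ac)
qed (simp add: mult.commute)

text \<open>Let \<open>n\<close> tend to infinity in \<open>gamma_ratio_cross_le\<close>: both
  shifted factors tend to \<open>1\<close>.\<close>

lemma gamma_ratio_mono:
  assumes "0 < z" "z \<le> w"
  shows "gamma_ratio z \<le> gamma_ratio w"
proof -
  have "(\<lambda>n. gamma_ratio z * gamma_ratio (w + real n)) \<longlonglongrightarrow> gamma_ratio z * 1"
    using assms by (intro tendsto_intros gamma_ratio_shift_tendsto) auto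
  moreover have "(\<lambda>n. gamma_ratio w * gamma_ratio (z + real n)) \<longlonglongrightarrow> gamma_ratio w * 1"
    using assms by (intro tendsto_intros gamma_ratio_shift_tendsto) auto
  ultimately have "gamma_ratio z * 1 \<le> gamma_ratio w * 1"
    by (rule LIMSEQ_le) (use gamma_ratio_cross_le[OF assms] in blast)
  then show ?thesis by simp
qed

lemma gamma_ratio_le_1: "0 < z \<Longrightarrow> gamma_ratio z \<le> 1"
  using gamma_ratio_square_le[of z] by (simp add: power2_le_iff_abs_le abs_square_le_1)

subsection \<open>Comparison of two densities\<close>

text \<open>The logarithm of the density up to an additive constant, in the variable
  \<open>y = x\<^sup>2\<close>. With this variable the difference of two exponents has a rational
  derivative.\<close>

definition student_exponent :: "ereal \<Rightarrow> real \<Rightarrow> real" where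
  "student_exponent p y = (if p = \<infinity> then - y / 2
     else - (real_of_ereal p + 1) / 2 * ln (1 + y / real_of_ereal p))"

lemma student_density_factor:
  assumes "0 < p"
  shows "student_density p x = student_density p 0 * exp (student_exponent p (x\<^sup>2))"
proof (cases p)
  case (real r)
  have "1 + x\<^sup>2 / r > 0"
    using assms real by (simp add: add_pos_nonneg)
  then show ?thesis
    using real by (simp add: student_density_def student_exponent_def powr_def Let_def)
next
  case PInf
  then show ?thesis
    by (simp add: student_density_def student_exponent_def std_normal_density_def)
qed (use assms in auto)

lemma student_density_zero_real:
  assumes "0 < r"
  shows "student_density (ereal r) 0 = gamma_ratio (r / 2) / sqrt (2 * pi)"
proof -
  have "sqrt (pi * r) = sqrt (2 * pi) * sqrt (r / 2)"
    by (simp flip: real_sqrt_mult)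
  then show ?thesis
    using assms by (simp add: student_density_def gamma_ratio_def add_divide_distrib)
qed

lemma student_density_zero_mono:
  assumes "0 < p" "p \<le> q"
  shows "student_density p 0 \<le> student_density q 0"
proof -
  have inf: "student_density \<infinity> 0 = 1 / sqrt (2 * pi)"
    by (simp add: student_density_def std_normal_density_def)
  consider r t where "p = ereal r" "q = ereal t" "0 < r" "r \<le> t"
    | r where "p = ereal r" "0 < r" "q = \<infinity>" | "p = \<infinity>" "q = \<infinity>"
    using assms by (cases p; cases q) auto
  then show ?thesis
    by cases (auto simp: student_density_zero_real inf intro!: divide_right_mono gamma_ratio_mono gamma_ratio_le_1)
qed

lemma student_density_zero_pos:
  assumes "0 < p"
  shows "0 < student_density p 0"
  using assms
  by (cases p) (auto simp: student_density_zero_real gamma_ratio_pos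
      student_density_def std_normal_density_def)

lemma student_density_pos:
  assumes "0 < p"
  shows "0 < student_density p x"
  using assms by (subst student_density_factor) (auto simp: student_density_zero_pos)

text \<open>Over a common denominator the two derivatives differ by a positive multiple of
  \<open>y - 1\<close>, so the turning point is the same for all \<open>p\<close> and
  \<open>q\<close>. The factor \<open>k\<close> may depend on \<open>y\<close>; only its sign
  matters later.\<close>

lemma DERIV_student_exponent_diff:
  assumes "0 < p" "p < q" "0 \<le> y"
  obtains k where "0 < k"
    "((\<lambda>y. student_exponent p y - student_exponent q y) has_real_derivative k * (y - 1)) (at y)"
proof -
  from assms obtain r where p: "p = ereal r" "0 < r"
    by (cases p) auto
  have pos: "0 < r + y" "0 < 1 + y / r"
    using p assms by (auto simp: add_pos_nonneg)
  show ?thesis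
  proof (cases q)
    case (real t)
    have t: "0 < r" "r < t" "0 < t + y" "0 < 1 + y / t"
      using p assms real by (auto simp: add_pos_nonneg)
    have "((\<lambda>y. student_exponent p y - student_exponent q y) has_real_derivative
        (t + 1) / 2 / (t + y) - (r + 1) / 2 / (r + y)) (at y)"
      unfolding student_exponent_def p real using t pos
      by (auto intro!: derivative_eq_intros simp: divide_simps) (auto simp: algebra_simps)
    moreover have "(t + 1) / 2 / (t + y) - (r + 1) / 2 / (r + y)
        = (t - r) / (2 * (t + y) * (r + y)) * (y - 1)"
      using t pos by (simp add: divide_simps) (simp add: algebra_simps)
    ultimately show ?thesis
      using t pos by (intro that[of "(t - r) / (2 * (t + y) * (r + y))"]) auto
  next
    case PInf
    have "((\<lambda>y. student_exponent p y - student_exponent q y) has_real_derivative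
        1 / 2 - (r + 1) / 2 / (r + y)) (at y)"
      unfolding student_exponent_def p PInf using p pos
      by (auto intro!: derivative_eq_intros simp: divide_simps) (auto simp: algebra_simps)
    moreover have "1 / 2 - (r + 1) / 2 / (r + y) = 1 / (2 * (r + y)) * (y - 1)"
      using pos(1) by (simp add: divide_simps) (simp add: algebra_simps)
    ultimately show ?thesis
      using pos by (intro that[of "1 / (2 * (r + y))"]) auto
  qed (use assms in auto)
qed

section \<open>Single sign changes and integrals against a monotone weight\<close>

text \<open>Starting at or below zero and decreasing, \<open>D\<close> is negative on
  \<open>(0, 1]\<close>. A zero exists beyond \<open>1\<close> by the intermediate value theorem,
  and the increase there makes it the only one.\<close>

lemma single_crossing:
  fixes D :: "real \<Rightarrow> real"
  assumes cont: "continuous_on {0..} D" and zero: "D 0 \<le> 0"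
    and decr: "strict_antimono_on {0..1} D" and incr: "strict_mono_on {1..} D"
    and pos: "\<exists>y\<ge>0. 0 < D y"
  obtains c where "1 < c" "\<And>y. 0 < y \<Longrightarrow> y < c \<Longrightarrow> D y < 0" "\<And>y. c < y \<Longrightarrow> 0 < D y"
proof -
  have neg: "D y < 0" if "0 < y" "y \<le> 1" for y
    using monotone_onD[OF decr, of 0 y] that zero by simp
  obtain v where v: "0 \<le> v" "0 < D v"
    using pos by auto
  have "1 < v"
    using neg[of v] v zero by (cases "v = 0") force+
  moreover have "continuous_on {1..v} D"
    using cont by (rule continuous_on_subset) auto
  ultimately obtain c where c: "1 \<le> c" "c \<le> v" "D c = 0"
    using IVT'[of D 1 0 v] neg[of 1] v by auto
  then have "c \<noteq> 1"
    using neg[of 1] by auto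
  show ?thesis
  proof (rule that)
    show "1 < c" using c \<open>c \<noteq> 1\<close> by simp
    show "D y < 0" if "0 < y" "y < c" for y
      using neg[of y] monotone_onD[OF incr, of y c] that c by (cases "y \<le> 1") auto
    show "0 < D y" if "c < y" for y
      using monotone_onD[OF incr, of c y] that c by auto
  qed
qed

text \<open>A nonempty open interval is not a null set. This refutes a reversed inequality almost
  everywhere, as strictness of integrals requires.\<close>

lemma AE_lborel_not_Ioo:
  fixes l u :: real
  assumes "AE x in lborel. P x" "l < u"
  obtains x where "l < x" "x < u" "P x"
proof (rule ccontr)
  assume contr: "\<not> thesis"
  have "AE x in lborel. x \<notin> {l<..<u}"
    using assms(1) by eventually_elim (use contr that in auto)
  then have "emeasure lborel {l<..<u} = 0"
    by (subst (asm) AE_iff_measurable[of "{l<..<u}"]) auto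
  then show False
    using assms(2) by simp
qed

text \<open>Away from \<open>0\<close>, \<open>f x - g x\<close> and
  \<open>b \<bar>x\<bar> - b c\<close> change sign together at \<open>\<bar>x\<bar> = c\<close>, and
  equal masses make the constant \<open>b c\<close> cancel. Strictness needs a finite smaller
  integral, since otherwise both sides are infinite.\<close>

lemma nn_integral_weighted_single_crossing:
  fixes f g b :: "real \<Rightarrow> real" and c :: real
  assumes [measurable]: "f \<in> borel_measurable borel" "g \<in> borel_measurable borel"
      "(\<lambda>x. b \<bar>x\<bar>) \<in> borel_measurable borel"
    and nonneg: "\<And>x. 0 \<le> f x" "\<And>x. 0 \<le> g x"
    and mass: "(\<integral>\<^sup>+x. ennreal (f x) \<partial>lborel) = 1" "(\<integral>\<^sup>+x. ennreal (g x) \<partial>lborel) = 1"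
    and c: "0 < c" and zero: "f 0 \<le> g 0"
    and less: "\<And>x. x \<noteq> 0 \<Longrightarrow> \<bar>x\<bar> < c \<Longrightarrow> f x < g x" and greater: "\<And>x. c < \<bar>x\<bar> \<Longrightarrow> g x < f x"
    and b_nonneg: "\<forall>x\<ge>0. 0 \<le> b x" and b_mono: "mono_on {0..} b"
  shows "(\<integral>\<^sup>+x. ennreal (g x) * ennreal (b \<bar>x\<bar>) \<partial>lborel)
      \<le> (\<integral>\<^sup>+x. ennreal (f x) * ennreal (b \<bar>x\<bar>) \<partial>lborel)" (is "?G \<le> ?F")
    and "\<not> b constant_on {0<..} \<Longrightarrow> (\<integral>\<^sup>+x. ennreal (g x) * ennreal (b \<bar>x\<bar>) \<partial>lborel) < \<infinity> \<Longrightarrow>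
      (\<integral>\<^sup>+x. ennreal (g x) * ennreal (b \<bar>x\<bar>) \<partial>lborel)
      < (\<integral>\<^sup>+x. ennreal (f x) * ennreal (b \<bar>x\<bar>) \<partial>lborel)"
proof -
  \<comment> \<open>Adding the finite \<open>b c\<close> on both sides, with the roles of \<open>f\<close> and \<open>g\<close> exchanged, avoids
    subtracting possibly infinite integrals.\<close>
  define lo where "lo x = ennreal (f x * b c + g x * b \<bar>x\<bar>)" for x
  define hi where "hi x = ennreal (g x * b c + f x * b \<bar>x\<bar>)" for x
  have [measurable]: "lo \<in> borel_measurable lborel" "hi \<in> borel_measurable lborel"
    unfolding lo_def hi_def by measurable
  have bc: "0 \<le> b c" using b_nonneg c by simp
  have split: "(\<integral>\<^sup>+x. ennreal (u x * b c + v x * b \<bar>x\<bar>) \<partial>lborel)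
      = ennreal (b c) + (\<integral>\<^sup>+x. ennreal (v x) * ennreal (b \<bar>x\<bar>) \<partial>lborel)"
    if [measurable]: "u \<in> borel_measurable borel" "v \<in> borel_measurable borel"
      and "\<And>x. 0 \<le> u x" "\<And>x. 0 \<le> v x" "(\<integral>\<^sup>+x. ennreal (u x) \<partial>lborel) = 1" for u v :: "real \<Rightarrow> real"
  proof -
    have "(\<integral>\<^sup>+x. ennreal (u x * b c + v x * b \<bar>x\<bar>) \<partial>lborel)
        = (\<integral>\<^sup>+x. ennreal (u x) * ennreal (b c) + ennreal (v x) * ennreal (b \<bar>x\<bar>) \<partial>lborel)"
      using that bc b_nonneg by (intro nn_integral_cong) (simp add: ennreal_mult ennreal_plus)
    also have "\<dots> = ennreal (b c) + (\<integral>\<^sup>+x. ennreal (v x) * ennreal (b \<bar>x\<bar>) \<partial>lborel)"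
      using that by (subst nn_integral_add) (auto simp: nn_integral_multc)
    finally show ?thesis .
  qed
  have lo: "(\<integral>\<^sup>+x. lo x \<partial>lborel) = ennreal (b c) + ?G"
    unfolding lo_def using nonneg mass by (intro split) auto
  have hi: "(\<integral>\<^sup>+x. hi x \<partial>lborel) = ennreal (b c) + ?F"
    unfolding hi_def using nonneg mass by (intro split) auto
  have mono: "b x \<le> b y" if "0 \<le> x" "x \<le> y" for x y
    using monotone_onD[OF b_mono, of x y] that by simp
  have diff: "(g x * b c + f x * b \<bar>x\<bar>) - (f x * b c + g x * b \<bar>x\<bar>) = (f x - g x) * (b \<bar>x\<bar> - b c)" for x
    by (simp add: algebra_simps)
  \<comment> \<open>At \<open>\<bar>x\<bar> = c\<close> the second factor vanishes, so the sign of
    \<open>f x - g x\<close> is irrelevant there; at \<open>x = 0\<close> the weak inequality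
    \<open>zero\<close> suffices.\<close>
  have "0 \<le> (f x - g x) * (b \<bar>x\<bar> - b c)" for x
  proof (cases \<open>\<bar>x\<bar>\<close> c rule: linorder_cases)
    case _: less
    then show ?thesis
      using less[of x] zero mono[of "\<bar>x\<bar>" c]
      by (cases "x = 0") (auto intro!: mult_nonpos_nonpos)
  next
    case _: greater
    then show ?thesis
      using greater[of x] mono[of c "\<bar>x\<bar>"] c by (auto intro!: mult_nonneg_nonneg)
  qed auto
  then have le: "lo x \<le> hi x" for x
    unfolding lo_def hi_def using diff[of x] by (intro ennreal_leI) (metis diff_ge_0_iff_ge)
  have "(\<integral>\<^sup>+x. lo x \<partial>lborel) \<le> (\<integral>\<^sup>+x. hi x \<partial>lborel)"
    by (intro nn_integral_mono le)
  then show "?G \<le> ?F"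
    unfolding lo hi by (simp add: ennreal_add_left_cancel_le)
  assume nonconst: "\<not> b constant_on {0<..}" and fin: "?G < \<infinity>"
  \<comment> \<open>Some \<open>u > 0\<close> has \<open>b u \<noteq> b c\<close>. Monotonicity
    carries this from \<open>u\<close> away from \<open>c\<close>: inwards to
    \<open>(u / 2, u)\<close>, which avoids \<open>0\<close>, or outwards to
    \<open>(u, u + 1)\<close>.\<close>
  obtain l r where lr: "0 < l" "l < r"
    and strict: "\<And>x. l < x \<Longrightarrow> x < r \<Longrightarrow> 0 < (f x - g x) * (b \<bar>x\<bar> - b c)"
  proof -
    obtain u where u: "0 < u" "b u \<noteq> b c"
      using nonconst by (auto simp: constant_on_def)
    show ?thesis
    proof (cases "u < c")
      case True
      show ?thesis
      proof (rule that[of "u / 2" u])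
        fix x assume x: "u / 2 < x" "x < u"
        then have "f x < g x"
          using u True by (intro less) auto
        moreover have "b \<bar>x\<bar> < b c"
          using x u True mono[of x u] mono[of u c] by simp
        ultimately show "0 < (f x - g x) * (b \<bar>x\<bar> - b c)"
          by (intro mult_neg_neg) auto
      qed (use u in auto)
    next
      case False
      with u have "c < u" by (cases "c = u") auto
      show ?thesis
      proof (rule that[of u "u + 1"])
        fix x assume x: "u < x" "x < u + 1"
        then have "g x < f x"
          using u \<open>c < u\<close> by (intro greater) auto
        moreover have "b c < b \<bar>x\<bar>"
          using x u \<open>c < u\<close> c mono[of u x] mono[of c u] by simp
        ultimately show "0 < (f x - g x) * (b \<bar>x\<bar> - b c)"
          by (intro mult_pos_pos) auto
      qed (use u in auto)
    qed
  qed
  have "\<not> (AE x in lborel. hi x \<le> lo x)"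
  proof
    assume "AE x in lborel. hi x \<le> lo x"
    then obtain x where x: "l < x" "x < r" "hi x \<le> lo x"
      using lr(2) by (rule AE_lborel_not_Ioo)
    \<comment> \<open>\<open>ennreal\<close> sends negative reals to \<open>0\<close>, so the real
      inequality can be recovered only with a nonnegative right-hand side.\<close>
    have "0 \<le> f x * b c + g x * b \<bar>x\<bar>"
      using nonneg bc b_nonneg by simp
    then have "g x * b c + f x * b \<bar>x\<bar> \<le> f x * b c + g x * b \<bar>x\<bar>"
      using x(3) by (simp add: lo_def hi_def ennreal_le_iff)
    then show False
      using strict[OF x(1,2)] diff[of x] by linarith
  qed
  then have "(\<integral>\<^sup>+x. lo x \<partial>lborel) < (\<integral>\<^sup>+x. hi x \<partial>lborel)"
    using le fin by (intro nn_integral_less) (auto simp: lo less_top)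
  then show "?G < ?F"
    unfolding lo hi by (simp add: ennreal_add_left_cancel_less)
qed

section \<open>Measurability, mass and crossing of Student densities\<close>

lemma borel_measurable_student_density [measurable]:
  "student_density p \<in> borel_measurable borel"
  by (cases "p = \<infinity>") (simp_all add: student_density_def[abs_def] Let_def)

text \<open>Nothing is known about \<open>b\<close> on negative arguments; freezing it there at
  \<open>b 0\<close> gives a globally monotone function with the same values at
  \<open>\<bar>x\<bar>\<close>.\<close>

lemma borel_measurable_mono_on_abs:
  fixes b :: "real \<Rightarrow> real"
  assumes "mono_on {0..} b"
  shows "(\<lambda>x. b \<bar>x\<bar>) \<in> borel_measurable borel"
proof -
  have "mono (\<lambda>x. b (max 0 x))"
    using assms by (intro monoI) (auto intro!: monotone_onD[OF assms])
  then have [measurable]: "(\<lambda>x. b (max 0 x)) \<in> borel_measurable borel"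
    by (rule borel_measurable_mono)
  have "(\<lambda>x. b (max 0 \<bar>x\<bar>)) \<in> borel_measurable borel"
    by measurable
  then show ?thesis
    by (simp add: max_absorb2)
qed

text \<open>The mass is read off from the random variable having this density, so no integral has to
  be evaluated.\<close>

lemma nn_integral_student_density:
  assumes "student_family M T" "0 < p"
  shows "(\<integral>\<^sup>+x. ennreal (student_density p x) \<partial>lborel) = 1"
proof -
  have D: "prob_space (M p)" "distributed (M p) lborel (T p) (\<lambda>x. ennreal (student_density p x))"
    using assms by (auto simp: student_family_def)
  have "(\<integral>\<^sup>+x. ennreal (student_density p x) * 1 \<partial>lborel) = (\<integral>\<^sup>+\<omega>. 1 \<partial>M p)"
    by (rule distributed_nn_integral[OF D(2)]) simp
  then show ?thesis
    using prob_space.emeasure_space_1[OF D(1)] by simp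
qed

lemma abs_moment_student:
  assumes "student_family M T" "0 < p" and [measurable]: "(\<lambda>x. b \<bar>x\<bar>) \<in> borel_measurable borel"
  shows "abs_moment (M p) b (T p)
    = (\<integral>\<^sup>+x. ennreal (student_density p x) * ennreal (b \<bar>x\<bar>) \<partial>lborel)"
proof -
  have "distributed (M p) lborel (T p) (\<lambda>x. ennreal (student_density p x))"
    using assms by (auto simp: student_family_def)
  then have "(\<integral>\<^sup>+x. ennreal (student_density p x) * ennreal (b \<bar>x\<bar>) \<partial>lborel)
      = (\<integral>\<^sup>+\<omega>. ennreal (b \<bar>T p \<omega>\<bar>) \<partial>M p)"
    by (rule distributed_nn_integral) simp
  then show ?thesis
    by (simp add: abs_moment_def)
qed

lemma student_density_crossing:
  assumes "0 < p" "p < q"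
    and mass: "(\<integral>\<^sup>+x. ennreal (student_density p x) \<partial>lborel) = 1"
      "(\<integral>\<^sup>+x. ennreal (student_density q x) \<partial>lborel) = 1"
  obtains c where "0 < c"
    "\<And>x. x \<noteq> 0 \<Longrightarrow> \<bar>x\<bar> < c \<Longrightarrow> student_density p x < student_density q x"
    "\<And>x. c < \<bar>x\<bar> \<Longrightarrow> student_density q x < student_density p x"
proof -
  \<comment> \<open>The constant \<open>a\<close> accounts for the values at the origin, so that
    \<open>D (x\<^sup>2)\<close> is the logarithm of the quotient of the two densities.\<close>
  define a where "a = ln (student_density p 0) - ln (student_density q 0)"
  define D where "D y = a + (student_exponent p y - student_exponent q y)" for y
  have "0 < q" using assms by simp
  have ln_density: "ln (student_density r x) = ln (student_density r 0) + student_exponent r (x\<^sup>2)"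
    if "0 < r" for r x
    using that student_density_zero_pos[OF that]
    by (subst student_density_factor) (auto simp: ln_mult)
  have D_ln: "D (x\<^sup>2) = ln (student_density p x) - ln (student_density q x)" for x
    unfolding D_def a_def using ln_density[OF \<open>0 < p\<close>, of x] ln_density[OF \<open>0 < q\<close>, of x] by linarith
  have D_neg: "D (x\<^sup>2) < 0 \<longleftrightarrow> student_density p x < student_density q x"
    and D_pos: "0 < D (x\<^sup>2) \<longleftrightarrow> student_density q x < student_density p x" for x
    using \<open>0 < p\<close> \<open>0 < q\<close> by (simp_all add: D_ln student_density_pos)
  have deriv: "\<exists>k>0. (D has_real_derivative k * (y - 1)) (at y)" if y: "0 \<le> y" for y
  proof -
    obtain k where "0 < k"
      "((\<lambda>y. student_exponent p y - student_exponent q y) has_real_derivative k * (y - 1)) (at y)"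
      using DERIV_student_exponent_diff[OF assms(1,2) y] by blast
    with DERIV_add[OF DERIV_const this(2), of a] show ?thesis
      unfolding D_def by auto
  qed
  have cont: "continuous_on {0..} D"
    using deriv by (intro continuous_at_imp_continuous_on ballI) (auto intro: DERIV_isCont)
  have "D 0 \<le> 0"
    using D_ln[of 0] student_density_zero_mono[OF assms(1) less_imp_le[OF assms(2)]]
      student_density_zero_pos[OF \<open>0 < p\<close>] by (simp add: ln_mono)
  have decr: "strict_antimono_on {0..1} D"
  proof (rule monotone_onI)
    fix x y :: real assume xy: "x \<in> {0..1}" "y \<in> {0..1}" "x < y"
    show "D y < D x"
    proof (rule DERIV_neg_imp_decreasing_open[OF xy(3)])
      show "\<exists>d. (D has_real_derivative d) (at t) \<and> d < 0" if t: "x < t" "t < y" for t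
      proof -
        obtain k where "0 < k" "(D has_real_derivative k * (t - 1)) (at t)"
          using deriv[of t] t xy by auto
        moreover have "k * (t - 1) < 0"
          using \<open>0 < k\<close> t xy by (intro mult_pos_neg) auto
        ultimately show ?thesis by blast
      qed
      show "continuous_on {x..y} D"
        using xy by (intro continuous_on_subset[OF cont]) auto
    qed
  qed
  have incr: "strict_mono_on {1..} D"
  proof (rule monotone_onI)
    fix x y :: real assume xy: "x \<in> {1..}" "y \<in> {1..}" "x < y"
    show "D x < D y"
    proof (rule DERIV_pos_imp_increasing_open[OF xy(3)])
      show "\<exists>d. (D has_real_derivative d) (at t) \<and> d > 0" if t: "x < t" "t < y" for t
      proof -
        obtain k where "0 < k" "(D has_real_derivative k * (t - 1)) (at t)"
          using deriv[of t] t xy by auto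
        moreover have "k * (t - 1) > 0"
          using \<open>0 < k\<close> t xy by (intro mult_pos_pos) auto
        ultimately show ?thesis by blast
      qed
      show "continuous_on {x..y} D"
        using xy by (intro continuous_on_subset[OF cont]) auto
    qed
  qed
  \<comment> \<open>Otherwise \<open>student_density p\<close> would lie below \<open>student_density q\<close>, strictly so near \<open>0\<close>,
    although both have mass \<open>1\<close>.\<close>
  have "\<exists>y\<ge>0. 0 < D y"
  proof (rule ccontr)
    assume "\<not> (\<exists>y\<ge>0. 0 < D y)"
    then have le: "student_density p x \<le> student_density q x" for x
      using D_pos[of x] by (meson not_le zero_le_power2)
    have "\<not> (AE x in lborel. ennreal (student_density q x) \<le> ennreal (student_density p x))"
    proof
      assume "AE x in lborel. ennreal (student_density q x) \<le> ennreal (student_density p x)"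
      then obtain x :: real where x: "0 < x" "x < 1"
        "ennreal (student_density q x) \<le> ennreal (student_density p x)"
        using zero_less_one by (rule AE_lborel_not_Ioo)
      have "D (x\<^sup>2) < D 0"
        using x by (intro monotone_onD[OF decr]) (auto simp: power_le_one)
      then have "student_density p x < student_density q x"
        using \<open>D 0 \<le> 0\<close> D_neg[of x] by linarith
      then show False
        using x(3) student_density_pos[OF \<open>0 < p\<close>, of x] by (simp add: ennreal_le_iff)
    qed
    then have "(\<integral>\<^sup>+x. ennreal (student_density p x) \<partial>lborel) < (\<integral>\<^sup>+x. ennreal (student_density q x) \<partial>lborel)"
      using le mass by (intro nn_integral_less) (auto intro: ennreal_leI)
    then show False
      using mass by simp
  qed
  then obtain c where c: "1 < c" "\<And>y. 0 < y \<Longrightarrow> y < c \<Longrightarrow> D y < 0" "\<And>y. c < y \<Longrightarrow> 0 < D y"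
    by (rule single_crossing[OF cont \<open>D 0 \<le> 0\<close> decr incr]) (rule that)
  show ?thesis
  proof (rule that)
    show "0 < sqrt c" using c by simp
    show "student_density p x < student_density q x" if "x \<noteq> 0" "\<bar>x\<bar> < sqrt c" for x
    proof -
      have "x\<^sup>2 < c"
        using that(2) c(1) by (metis real_sqrt_abs real_sqrt_less_iff)
      then show ?thesis
        using that c(2)[of "x\<^sup>2"] D_neg[of x] by simp
    qed
    show "student_density q x < student_density p x" if "sqrt c < \<bar>x\<bar>" for x
    proof -
      have "c < x\<^sup>2"
        using that c(1) by (metis real_sqrt_abs real_sqrt_less_iff)
      then show ?thesis
        using c(3)[of "x\<^sup>2"] D_pos[of x] by simp
    qed
  qed
qed

subsection \<open>Comparison of moments\<close>

lemma abs_moment_student_le: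
  assumes "student_family M T" "0 < p" "p \<le> q"
    and "\<forall>x\<ge>0. 0 \<le> b x" "mono_on {0..} b"
  shows "abs_moment (M q) b (T q) \<le> abs_moment (M p) b (T p)"
proof (cases "p = q")
  case False
  then have "p < q" "0 < q" using assms by auto
  note mass = nn_integral_student_density[OF assms(1) \<open>0 < p\<close>] nn_integral_student_density[OF assms(1) \<open>0 < q\<close>]
  note meas = borel_measurable_mono_on_abs[OF assms(5)]
  obtain c where c: "0 < c"
    "\<And>x. x \<noteq> 0 \<Longrightarrow> \<bar>x\<bar> < c \<Longrightarrow> student_density p x < student_density q x"
    "\<And>x. c < \<bar>x\<bar> \<Longrightarrow> student_density q x < student_density p x"
    using student_density_crossing[OF \<open>0 < p\<close> \<open>p < q\<close> mass] by blast
  have zero: "student_density p 0 \<le> student_density q 0"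
    using assms by (intro student_density_zero_mono)
  show ?thesis
    unfolding abs_moment_student[OF assms(1) \<open>0 < p\<close> meas] abs_moment_student[OF assms(1) \<open>0 < q\<close> meas]
    by (rule nn_integral_weighted_single_crossing(1)[OF _ _ meas _ _ mass c(1) zero c(2,3) assms(4,5)])
      (simp_all add: \<open>0 < p\<close> \<open>0 < q\<close> student_density_pos less_imp_le)
qed simp

text \<open>Finiteness is asked only at the larger index \<open>q\<close>. The moment at
  \<open>p\<close> may be infinite, which lets left endpoints be included later.\<close>

lemma abs_moment_student_less:
  assumes "student_family M T" "0 < p" "p < q"
    and "\<forall>x\<ge>0. 0 \<le> b x" "mono_on {0..} b" "\<not> b constant_on {0<..}"
    and "abs_moment (M q) b (T q) < \<infinity>"
  shows "abs_moment (M q) b (T q) < abs_moment (M p) b (T p)"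
proof -
  have "0 < q" using assms by auto
  note mass = nn_integral_student_density[OF assms(1) \<open>0 < p\<close>] nn_integral_student_density[OF assms(1) \<open>0 < q\<close>]
  note meas = borel_measurable_mono_on_abs[OF assms(5)]
  note eq = abs_moment_student[OF assms(1) \<open>0 < p\<close> meas] abs_moment_student[OF assms(1) \<open>0 < q\<close> meas]
  obtain c where c: "0 < c"
    "\<And>x. x \<noteq> 0 \<Longrightarrow> \<bar>x\<bar> < c \<Longrightarrow> student_density p x < student_density q x"
    "\<And>x. c < \<bar>x\<bar> \<Longrightarrow> student_density q x < student_density p x"
    using student_density_crossing[OF \<open>0 < p\<close> \<open>p < q\<close> mass] by blast
  have zero: "student_density p 0 \<le> student_density q 0"
    using assms by (intro student_density_zero_mono) auto
  show ?thesis
    unfolding eq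
    by (rule nn_integral_weighted_single_crossing(2)[OF _ _ meas _ _ mass c(1) zero c(2,3)
          assms(4,5,6) assms(7)[unfolded eq]])
      (simp_all add: \<open>0 < p\<close> \<open>0 < q\<close> student_density_pos less_imp_le)
qed

text \<open>Up to a constant factor, \<open>\<bar>x\<bar> powr s\<close> times the density with \<open>q\<close> degrees of freedom is
  dominated by the density with \<open>q - s\<close> degrees of freedom, whose mass is known to be finite.\<close>

lemma abs_moment_student_powr_finite:
  assumes "student_family M T" "0 < s" "s < q"
  shows "abs_moment (M (ereal q)) (\<lambda>x. x powr s) (T (ereal q)) < \<infinity>"
proof -
  define r where "r = q - s"
  have pos: "0 < r" "0 < q" "r < q" using assms by (auto simp: r_def)
  define A B where "A = student_density (ereal q) 0" and "B = student_density (ereal r) 0"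
  have AB: "0 < A" "0 < B" using pos by (simp_all add: A_def B_def student_density_zero_pos)
  define e where "e = (r + 1) / 2"
  \<comment> \<open>\<open>A / B\<close> exchanges the values at \<open>0\<close>,
    \<open>q powr (s / 2)\<close> comes from bounding \<open>x\<^sup>2\<close> by
    \<open>q * w\<close>, and the last factor from replacing \<open>w\<close> by a multiple of
    \<open>1 + x\<^sup>2 / r\<close>.\<close>
  define C where "C = A / B * q powr (s / 2) * (r / q) powr - e"
  have powr_form: "student_density (ereal t) x = student_density (ereal t) 0 * (1 + x\<^sup>2 / t) powr (- (t + 1) / 2)"
    for t x by (simp add: student_density_def)
  have bound: "student_density (ereal q) x * \<bar>x\<bar> powr s \<le> C * student_density (ereal r) x" for x
  proof -
    define w where "w = 1 + x\<^sup>2 / q"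
    have w: "0 < w" using pos by (simp add: w_def add_pos_nonneg)
    have "\<bar>x\<bar> powr s = (x\<^sup>2) powr (s / 2)"
      using powr_powr[of "\<bar>x\<bar>" 2 "s / 2"] by (cases "x = 0") simp_all
    also have "\<dots> \<le> (q * w) powr (s / 2)"
      using pos assms by (intro powr_mono2) (auto simp: w_def algebra_simps)
    also have "\<dots> = q powr (s / 2) * w powr (s / 2)"
      using pos w by (simp add: powr_mult)
    finally have "student_density (ereal q) x * \<bar>x\<bar> powr s
        \<le> (A * w powr (- (q + 1) / 2)) * (q powr (s / 2) * w powr (s / 2))"
      unfolding powr_form[of q x] A_def[symmetric] w_def[symmetric]
      using AB by (intro mult_left_mono) auto
    also have "\<dots> = A * q powr (s / 2) * w powr (- (q + 1) / 2 + s / 2)"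
      by (simp add: powr_add mult_ac)
    also have "- (q + 1) / 2 + s / 2 = - e"
      by (simp add: e_def r_def field_simps)
    \<comment> \<open>Since \<open>r < q\<close>, the new base \<open>r / q + x\<^sup>2 / q\<close>
      is at most \<open>w\<close>, and the negative exponent reverses the inequality.\<close>
    also have "A * q powr (s / 2) * w powr - e
        \<le> A * q powr (s / 2) * (r / q * (1 + x\<^sup>2 / r)) powr - e"
    proof (intro mult_left_mono powr_mono2')
      show "- e \<le> 0" using pos by (simp add: e_def)
      show "0 < r / q * (1 + x\<^sup>2 / r)"
        using pos by (intro mult_pos_pos add_pos_nonneg) auto
      show "r / q * (1 + x\<^sup>2 / r) \<le> w" using pos by (simp add: w_def field_simps)
    qed (use AB in auto)
    also have "(r / q * (1 + x\<^sup>2 / r)) powr - e = (r / q) powr - e * (1 + x\<^sup>2 / r) powr - e"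
      by (rule powr_mult)
    also have "A * q powr (s / 2) * \<dots> = C * (B * (1 + x\<^sup>2 / r) powr - e)"
      using AB by (simp add: C_def)
    also have "B * (1 + x\<^sup>2 / r) powr - e = student_density (ereal r) x"
      unfolding powr_form[of r x] B_def e_def by (simp add: minus_divide_left)
    finally show ?thesis .
  qed
  have "0 \<le> C" using AB by (simp add: C_def)
  have "abs_moment (M (ereal q)) (\<lambda>x. x powr s) (T (ereal q))
      = (\<integral>\<^sup>+x. ennreal (student_density (ereal q) x) * ennreal (\<bar>x\<bar> powr s) \<partial>lborel)"
    using assms pos by (intro abs_moment_student) auto
  also have "\<dots> \<le> (\<integral>\<^sup>+x. ennreal C * ennreal (student_density (ereal r) x) \<partial>lborel)"
    using pos \<open>0 \<le> C\<close> bound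
    by (intro nn_integral_mono)
      (auto simp: student_density_pos less_imp_le simp flip: ennreal_mult intro!: ennreal_leI)
  also have "\<dots> = ennreal C"
    using nn_integral_student_density[OF assms(1), of "ereal r"] pos by (simp add: nn_integral_cmult)
  finally show ?thesis
    by (simp add: le_less_trans less_top)
qed

text \<open>At the critical power the integrand is at least a positive multiple of
  \<open>1 / x\<close> for \<open>x \<ge> 1\<close>, so the integral diverges
  logarithmically.\<close>

lemma abs_moment_student_powr_infinite:
  assumes "student_family M T" "0 < s"
  shows "abs_moment (M (ereal s)) (\<lambda>x. x powr s) (T (ereal s)) = \<infinity>"
proof -
  \<comment> \<open>The constant comes from
    \<open>1 + x\<^sup>2 / s \<le> x\<^sup>2 * (1 + 1 / s)\<close> for
    \<open>x \<ge> 1\<close>.\<close>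
  define C where "C = student_density (ereal s) 0 * (1 + 1 / s) powr (- (s + 1) / 2)"
  have "1 + 1 / s \<noteq> 0"
    using assms by (simp add: add_pos_pos less_imp_neq[symmetric])
  then have "0 < C"
    using assms student_density_zero_pos[of "ereal s"] by (simp add: C_def)
  have bound: "C / x \<le> student_density (ereal s) x * \<bar>x\<bar> powr s" if "1 \<le> x" for x
  proof -
    have "1 \<le> x\<^sup>2" using that by simp
    have "(x\<^sup>2 * (1 + 1 / s)) powr (- (s + 1) / 2) \<le> (1 + x\<^sup>2 / s) powr (- (s + 1) / 2)"
      using assms \<open>1 \<le> x\<^sup>2\<close> by (intro powr_mono2') (auto simp: algebra_simps add_pos_nonneg)
    moreover have "(x\<^sup>2 * (1 + 1 / s)) powr (- (s + 1) / 2)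
        = x powr (- (s + 1)) * (1 + 1 / s) powr (- (s + 1) / 2)"
    proof -
      have "x\<^sup>2 = x powr 2"
        using that by simp
      also have "(x powr 2) powr (- (s + 1) / 2) = x powr (2 * (- (s + 1) / 2))"
        by (rule powr_powr)
      also have "2 * (- (s + 1) / 2) = - (s + 1)"
        by simp
      finally have "(x\<^sup>2) powr (- (s + 1) / 2) = x powr (- (s + 1))" .
      then show ?thesis
        using assms by (simp add: powr_mult)
    qed
    ultimately have "x powr (- (s + 1)) * (1 + 1 / s) powr (- (s + 1) / 2) * (student_density (ereal s) 0 * x powr s)
        \<le> (1 + x\<^sup>2 / s) powr (- (s + 1) / 2) * (student_density (ereal s) 0 * x powr s)"
      using assms student_density_zero_pos[of "ereal s"] by (intro mult_right_mono) auto
    also have "\<dots> = student_density (ereal s) x * \<bar>x\<bar> powr s"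
      using that by (simp add: student_density_def)
    also have "x powr (- (s + 1)) * (1 + 1 / s) powr (- (s + 1) / 2) * (student_density (ereal s) 0 * x powr s)
        = C * (x powr (- (s + 1)) * x powr s)"
      by (simp add: C_def)
    also have "x powr (- (s + 1)) * x powr s = 1 / x"
      using that by (simp add: powr_minus_divide flip: powr_add)
    finally show ?thesis by simp
  qed
  let ?E = "abs_moment (M (ereal s)) (\<lambda>x. x powr s) (T (ereal s))"
  \<comment> \<open>Cutting off at \<open>exp (real n)\<close> makes the integral of
    \<open>C / x\<close> exactly \<open>C * real n\<close>, which is unbounded in
    \<open>n\<close>.\<close>
  have *: "ennreal (C * real n) \<le> ?E" for n
  proof -
    have "((\<lambda>x. C * ln x) has_real_derivative C / x) (at x)" if "1 \<le> x" for x
      using that by (auto intro!: derivative_eq_intros)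
    then have "(\<integral>\<^sup>+x. ennreal (C / x) * indicator {1..exp (real n)} x \<partial>lborel)
        = ennreal (C * ln (exp (real n)) - C * ln 1)"
      using \<open>0 < C\<close> by (intro nn_integral_FTC_Icc) auto
    then have "ennreal (C * real n) = (\<integral>\<^sup>+x. ennreal (C / x) * indicator {1..exp (real n)} x \<partial>lborel)"
      by simp
    also have "\<dots> \<le> (\<integral>\<^sup>+x. ennreal (student_density (ereal s) x) * ennreal (\<bar>x\<bar> powr s) \<partial>lborel)"
      using assms bound
      by (intro nn_integral_mono)
        (auto simp: student_density_pos less_imp_le simp flip: ennreal_mult intro!: ennreal_leI
          split: split_indicator)
    also have "\<dots> = ?E"
      using assms by (intro abs_moment_student[symmetric]) auto
    finally show ?thesis .
  qed
  show ?thesis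
  proof (cases ?E)
    case (real u)
    obtain n where "u / C < real n" using reals_Archimedean2 by blast
    then have "u < C * real n" using \<open>0 < C\<close> by (simp add: field_simps)
    then show ?thesis using *[of n] real by simp
  qed simp
qed

text \<open>The intervals are taken in \<open>ereal\<close> and so reach up to \<infinity>. A
  bounded \<open>b\<close> gives \<open>p\<^sub>b = 0\<close>, hence the intersection with
  \<open>{0<..}\<close>.\<close>

theorem corollary1p2:
  fixes M :: "ereal \<Rightarrow> 'a measure"
    and T :: "ereal \<Rightarrow> 'a \<Rightarrow> real"
    and b :: "real \<Rightarrow> real"
  assumes student: "student_family M T"
    and b_nonneg: "\<forall>x\<ge>0. 0 \<le> b x"
    and b_mono: "mono_on {0..} b"
    and b_nonconst: "\<not> b constant_on {0<..}"
  shows "(antimono_on {0<..} (\<lambda>p. abs_moment (M p) b (T p))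
          \<and> (\<exists>p\<^sub>b\<ge>0. (finiteness_set M T b = {p\<^sub>b..} \<or> finiteness_set M T b = {p\<^sub>b<..})
               \<and> strict_antimono_on ({0<..} \<inter> {p\<^sub>b..}) (\<lambda>p. abs_moment (M p) b (T p))))
       \<and> (\<forall>s::real. 0 < s \<longrightarrow>
            strict_antimono_on {ereal s..} (\<lambda>p. abs_moment (M p) (\<lambda>x. x powr s) (T p))
            \<and> abs_moment (M (ereal s)) (\<lambda>x. x powr s) (T (ereal s)) = \<infinity>)"
proof (intro conjI allI impI)
  show "antimono_on {0<..} (\<lambda>p. abs_moment (M p) b (T p))"
    by (rule monotone_onI) (use abs_moment_student_le[OF student _ _ b_nonneg b_mono] in auto)
  let ?F = "finiteness_set M T b"
  \<comment> \<open>The infimum is taken in the complete lattice \<open>ereal\<close>: an empty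
    \<open>?F\<close> gives \<open>p\<^sub>b = \<infinity>\<close>, and then
    \<open>{p\<^sub>b<..}\<close> is empty as well.\<close>
  define p\<^sub>b where "p\<^sub>b = Inf ?F"
  have upward: "q \<in> ?F" if "p \<in> ?F" "p \<le> q" for p q
    using that abs_moment_student_le[OF student _ _ b_nonneg b_mono, of p q]
    unfolding finiteness_set_def by auto
  have above: "q \<in> ?F" if "p\<^sub>b < q" for q
    using that upward unfolding p\<^sub>b_def Inf_less_iff by (meson less_imp_le)
  have below: "p\<^sub>b \<le> q" if "q \<in> ?F" for q
    unfolding p\<^sub>b_def using that by (rule Inf_lower)
  show "\<exists>p\<^sub>b\<ge>0. (?F = {p\<^sub>b..} \<or> ?F = {p\<^sub>b<..})
      \<and> strict_antimono_on ({0<..} \<inter> {p\<^sub>b..}) (\<lambda>p. abs_moment (M p) b (T p))"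
  proof (intro exI conjI)
    show "0 \<le> p\<^sub>b"
      unfolding p\<^sub>b_def by (rule Inf_greatest) (auto simp: finiteness_set_def)
    show "?F = {p\<^sub>b..} \<or> ?F = {p\<^sub>b<..}"
    proof (cases "p\<^sub>b \<in> ?F")
      case True
      then show ?thesis using below upward by auto
    next
      case False
      then show ?thesis using below above by (metis antisym_conv2 greaterThan_iff subsetI subset_antisym)
    qed
    show "strict_antimono_on ({0<..} \<inter> {p\<^sub>b..}) (\<lambda>p. abs_moment (M p) b (T p))"
    proof (rule monotone_onI)
      \<comment> \<open>Here \<open>q\<close> lies strictly above \<open>p\<^sub>b\<close>, so its
        moment is finite even if \<open>p = p\<^sub>b\<close> is outside \<open>?F\<close>.\<close>
      fix p q :: ereal assume "p \<in> {0<..} \<inter> {p\<^sub>b..}" "p < q"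
      then show "abs_moment (M q) b (T q) < abs_moment (M p) b (T p)"
        using above[of q]
        by (intro abs_moment_student_less[OF student _ _ b_nonneg b_mono b_nonconst])
          (auto simp: finiteness_set_def)
    qed
  qed
next
  fix s :: real assume s: "0 < s"
  have nonneg: "\<forall>x\<ge>0::real. 0 \<le> x powr s" by simp
  have mono: "mono_on {0..} (\<lambda>x::real. x powr s)"
    using s by (intro mono_onI powr_mono2) auto
  have nonconst: "\<not> (\<lambda>x::real. x powr s) constant_on {0<..}"
  proof (rule not_constant_onI)
    show "(1::real) powr s \<noteq> 2 powr s" using s powr_less_mono2[of s 1 2] by simp
  qed auto
  show "abs_moment (M (ereal s)) (\<lambda>x. x powr s) (T (ereal s)) = \<infinity>"
    using student s by (rule abs_moment_student_powr_infinite)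
  show "strict_antimono_on {ereal s..} (\<lambda>p. abs_moment (M p) (\<lambda>x. x powr s) (T p))"
  proof (rule monotone_onI)
    fix p q :: ereal assume p: "p \<in> {ereal s..}" "p < q"
    then have "ereal s < q" by auto
    \<comment> \<open>As \<open>q\<close> may be infinite, finiteness is first obtained at a real
      \<open>t\<close> above \<open>s\<close> and then passed up to \<open>q\<close> by
      monotonicity.\<close>
    then obtain t where t: "s < t" "ereal t \<le> q"
      by (metis ereal_dense2 less_ereal.simps(1) less_imp_le)
    have "abs_moment (M q) (\<lambda>x. x powr s) (T q) \<le> abs_moment (M (ereal t)) (\<lambda>x. x powr s) (T (ereal t))"
      using s t by (intro abs_moment_student_le[OF student _ _ nonneg mono]) auto
    also have "\<dots> < \<infinity>"
      using student s t by (intro abs_moment_student_powr_finite)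
    finally show "abs_moment (M q) (\<lambda>x. x powr s) (T q) < abs_moment (M p) (\<lambda>x. x powr s) (T p)"
      using s p by (intro abs_moment_student_less[OF student _ _ nonneg mono nonconst])
        (auto intro: less_le_trans[of _ "ereal s"])
  qed
qed

end
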